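(* For all $s \in \mathbb{C}$, \begin{equation*} \mathcal{C}_k(z,k-s) = e^{s i \pi} N^{k/2-s}\, \mathcal{C}_k( z, s)|_k \omega . \end{equation*}
   Context: Let $N\geqslant 1$ be an integer and $\Gamma=\Gamma_0(N)$ the Hecke congruence group of level $N$; let $k\geqslant 6$ be an even integer and $z\in\mathbb{H}$. For $\gamma=\left(\begin{smallmatrix} a & b\\ c& d\end{smallmatrix}\right)$ put $j(\gamma,z)=cz+d$, and for $s\in\mathbb{C}$ define $z^s=e^{s\log z}$ with the principal branch of the logarithm. Cohen's kernel is $$\mathcal{C}_k(z,s)=\sum_{\gamma\in\Gamma}\frac{1}{(\gamma z)^s\, j(\gamma,z)^k},$$ absolutely convergent for $1<\mathrm{Re}(s)<k-1$, and extended to all $s\in\mathbb{C}$ by analytic continuation (it is a weight $k$ cusp form for $\Gamma_0(N)$ in $z$). Let $\omega=\left(\begin{smallmatrix} 0 & -1 \\ N & 0\end{smallmatrix}\right)$ and for a function $f$ on $\mathbb{H}$ let $(f|_k\omega)(z)=(\det\omega)^{k/2} j(\omega,z)^{-k} f(\omega z)=N^{k/2}(Nz)^{-k}f(-1/(Nz))$; here $\mathcal{C}_k(z,s)|_k\omega$ denotes this operator applied in the variable $z$. *)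

theory Defs
  imports "HOL-Complex_Analysis.Complex_Analysis"
begin

definition Gamma0 :: "nat \<Rightarrow> (int^2^2) set" where
  "Gamma0 N = {\<gamma>. det \<gamma> = 1 \<and> int N dvd \<gamma>$2$1}"

definition jfactor :: "int^2^2 \<Rightarrow> complex \<Rightarrow> complex" where
  "jfactor \<gamma> z = of_int (\<gamma>$2$1) * z + of_int (\<gamma>$2$2)"

definition moebius :: "int^2^2 \<Rightarrow> complex \<Rightarrow> complex" where
  "moebius \<gamma> z = (of_int (\<gamma>$1$1) * z + of_int (\<gamma>$1$2)) / (of_int (\<gamma>$2$1) * z + of_int (\<gamma>$2$2))"

definition slash :: "nat \<Rightarrow> int^2^2 \<Rightarrow> (complex \<Rightarrow> complex) \<Rightarrow> complex \<Rightarrow> complex" where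
  "slash k \<gamma> f z =
     of_real (real_of_int (det \<gamma>) powr (real k / 2)) / jfactor \<gamma> z ^ k * f (moebius \<gamma> z)"

definition omega :: "nat \<Rightarrow> int^2^2" where
  "omega N = vector [vector [0, -1], vector [int N, 0]]"

text \<open>
  The complex power is the principal one, and the unordered infinite sum of complex terms
  is absolute summation.
\<close>

definition cohen_series :: "nat \<Rightarrow> nat \<Rightarrow> complex \<Rightarrow> complex \<Rightarrow> complex" where
  "cohen_series N k z s =
     (\<Sum>\<^sub>\<infinity>\<gamma>\<in>Gamma0 N. 1 / (moebius \<gamma> z powr s * jfactor \<gamma> z ^ k))"

text \<open>
  The entire function extending \<open>f\<close> from \<open>S\<close>; it is unique if \<open>S\<close> has a limit point.
  As usual for partial operations, the value is \<open>0\<close> if there is no extension.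
\<close>

definition entire_continuation ::
    "complex set \<Rightarrow> (complex \<Rightarrow> complex) \<Rightarrow> complex \<Rightarrow> complex" where
  "entire_continuation S f =
     (if \<exists>F. F holomorphic_on UNIV \<and> (\<forall>s\<in>S. F s = f s)
      then THE F. F holomorphic_on UNIV \<and> (\<forall>s\<in>S. F s = f s)
      else (\<lambda>_. 0))"

text \<open>The strip below is the one on which the series converges absolutely.\<close>

definition cohen_kernel :: "nat \<Rightarrow> nat \<Rightarrow> complex \<Rightarrow> complex \<Rightarrow> complex" where
  "cohen_kernel N k z =
     entire_continuation {s. 1 < Re s \<and> Re s < real k - 1} (cohen_series N k z)"

end

theory Submission
  imports Defs
begin

no_notation fps_nth (infixl \<open>$\<close> 75)

text \<open>
  The Fricke matrix \<open>\<omega>\<close> normalises \<open>\<Gamma>\<^sub>0(N)\<close>, so replacing \<open>\<gamma>\<close> by \<open>\<omega> \<gamma> \<omega>\<inverse>\<close> merely permutes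
  the terms of Cohen's series. Since \<open>log (-1/w) = i \<pi> - log w\<close> in the upper half plane, each
  term at \<open>(\<omega> z, s)\<close> becomes, up to an entire nonvanishing factor depending only on \<open>s\<close>, a term at
  \<open>(z, k - s)\<close>. The strip of convergence is symmetric under \<open>s \<mapsto> k - s\<close>, so the identity of the
  series transfers to the entire continuations, and one of these exists iff the other does.
\<close>

text \<open>By the identity theorem on the connected plane, two entire functions agreeing on
  \<open>S\<close> coincide. So exhibiting one extension evaluates the definite description.\<close>

lemma entire_continuation_eqI:
  assumes "open S" "S \<noteq> {}" "F holomorphic_on UNIV" "\<And>s. s \<in> S \<Longrightarrow> F s = f s"
  shows "entire_continuation S f = F"
proof -
  have "G = F" if "G holomorphic_on UNIV" "\<forall>s\<in>S. G s = f s" for G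
  proof
    fix s
    show "G s = F s"
      by (rule analytic_continuation_open[OF assms(1) open_UNIV assms(2) connected_UNIV])
         (use assms that in auto)
  qed
  then have "(THE F. F holomorphic_on UNIV \<and> (\<forall>s\<in>S. F s = f s)) = F"
    using assms(3,4) by (intro the_equality) blast+
  moreover have "\<exists>F. F holomorphic_on UNIV \<and> (\<forall>s\<in>S. F s = f s)"
    using assms(3,4) by blast
  ultimately show ?thesis
    unfolding entire_continuation_def by presburger
qed

text \<open>If F extends \<open>f\<close>, then F (c - s) / h s extends \<open>g\<close>; this is
  where \<open>h\<close> must not vanish. The symmetry of \<open>S\<close> keeps c - s inside the
  set where F is known.\<close>

lemma entire_continuation_reflect:
  assumes S: "open S" "S \<noteq> {}" "\<And>s. s \<in> S \<Longrightarrow> c - s \<in> S"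
    and h: "h holomorphic_on UNIV" "\<And>s. h s \<noteq> 0"
    and fg: "\<And>s. s \<in> S \<Longrightarrow> f (c - s) = h s * g s"
  shows "entire_continuation S f (c - s) = h s * entire_continuation S g s"
proof (cases "\<exists>F. F holomorphic_on UNIV \<and> (\<forall>s\<in>S. F s = f s)")
  case True
  then obtain F where F: "F holomorphic_on UNIV" "\<And>s. s \<in> S \<Longrightarrow> F s = f s" by blast
  have "(F \<circ> (\<lambda>s. c - s)) holomorphic_on UNIV"
    by (rule holomorphic_on_compose_gen[OF _ F(1)]) (auto intro!: holomorphic_intros)
  then have "(\<lambda>s. F (c - s) / h s) holomorphic_on UNIV"
    using h by (auto intro!: holomorphic_on_divide simp: o_def)
  then have "entire_continuation S g = (\<lambda>s. F (c - s) / h s)"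
    by (rule entire_continuation_eqI[OF S(1,2)]) (simp add: F S fg h)
  moreover have "entire_continuation S f = F"
    by (rule entire_continuation_eqI[OF S(1,2) F])
  ultimately show ?thesis using h by simp
next
  case False
  \<comment> \<open>An extension of \<open>g\<close> would give one of \<open>f\<close> by the
    inverse substitution, so both continuations take the default value 0 and the identity reads 0 =
    h s * 0.\<close>
  have "\<not> (\<exists>G. G holomorphic_on UNIV \<and> (\<forall>s\<in>S. G s = g s))"
  proof
    assume "\<exists>G. G holomorphic_on UNIV \<and> (\<forall>s\<in>S. G s = g s)"
    then obtain G where G: "G holomorphic_on UNIV" "\<And>s. s \<in> S \<Longrightarrow> G s = g s" by blast
    have "(\<lambda>s. h s * G s) holomorphic_on UNIV"
      using h G by (intro holomorphic_intros)
    then have "((\<lambda>s. h s * G s) \<circ> (\<lambda>s. c - s)) holomorphic_on UNIV"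
      by (rule holomorphic_on_compose_gen[rotated]) (auto intro!: holomorphic_intros)
    moreover have "((\<lambda>s. h s * G s) \<circ> (\<lambda>s. c - s)) s = f s" if "s \<in> S" for s
      using fg[of "c - s"] S(3)[OF that] G(2) by simp
    ultimately show False using False by blast
  qed
  with False show ?thesis
    unfolding entire_continuation_def by (simp only: if_False mult_zero_right)
qed

lemma jfactor_nonzero:
  assumes "det \<gamma> = 1" "Im z > 0"
  shows "jfactor \<gamma> z \<noteq> 0"
proof
  assume "jfactor \<gamma> z = 0"
  then have "Im (jfactor \<gamma> z) = 0" "Re (jfactor \<gamma> z) = 0" by simp_all
  then have "\<gamma>$2$1 = 0" "\<gamma>$2$2 = 0" using assms(2) by (auto simp: jfactor_def)
  with assms(1) show False by (simp add: det_2)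
qed

lemma Im_moebius_pos:
  assumes "det \<gamma> = 1" "Im z > 0"
  shows "Im (moebius \<gamma> z) > 0"
proof -
  define a b c d where "a = real_of_int (\<gamma>$1$1)" and "b = real_of_int (\<gamma>$1$2)"
    and "c = real_of_int (\<gamma>$2$1)" and "d = real_of_int (\<gamma>$2$2)"
  have "real_of_int (det \<gamma>) = a * d - b * c"
    by (simp add: det_2 a_def b_def c_def d_def)
  then have det: "a * d - b * c = 1" using assms by simp
  \<comment> \<open>The sign of Im (u / v) is that of Im (u * cnj v), which avoids dividing by the
    squared norm of v.\<close>
  have "Im ((of_real a * z + of_real b) * cnj (of_real c * z + of_real d)) = (a * d - b * c) * Im z"
    by (simp add: algebra_simps)
  moreover have "moebius \<gamma> z = (of_real a * z + of_real b) / (of_real c * z + of_real d)"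
    by (simp add: moebius_def a_def b_def c_def d_def)
  moreover have "of_real c * z + of_real d \<noteq> 0"
    using jfactor_nonzero[OF assms] by (simp add: jfactor_def c_def d_def)
  ultimately show ?thesis
    using det assms(2) by (simp add: Im_complex_div_gt_0)
qed

text \<open>Principal logarithms add here without a multiple of 2 pi i: the argument of -1/w is pi -
  arg w, again in (0, pi), and 1/N is a positive real. The pi produces the exponential factor of the
  theorem.\<close>

lemma minus_inverse_powr:
  assumes "Im w > 0" "N > 0"
  shows "(- 1 / (of_nat N * w)) powr s = exp (s * \<i> * of_real pi) * of_nat N powr (- s) * w powr (- s)"
proof -
  have w: "w \<noteq> 0" using assms by auto
  have "- 1 / (of_nat N * w) = of_real (1 / real N) * (- inverse w)"
    using assms by (simp add: field_simps)
  moreover have "Ln (of_real (1 / real N) * (- inverse w)) = of_real (ln (1 / real N)) + Ln (- inverse w)"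
    using w assms Ln_times_of_real[of "1 / real N" "- inverse w"] Ln_of_real[of "1 / real N"]
    by (simp del: of_real_divide)
  moreover have "Ln (- inverse w) = \<i> * of_real pi - Ln w"
  proof -
    \<comment> \<open>This sign selects + \<i> pi rather than - \<i> pi in
      \<open>Ln_minus\<close>.\<close>
    have "Im (inverse w) < 0" using assms by (simp add: Im_complex_div_lt_0 inverse_eq_divide)
    moreover have "w \<notin> \<real>\<^sub>\<le>\<^sub>0"
      using assms by (auto simp: complex_nonpos_Reals_iff)
    ultimately show ?thesis using w assms(1)
      by (simp add: Ln_minus Ln_inverse)
  qed
  moreover have "of_real (ln (1 / real N)) = - Ln (of_nat N)"
    using assms Ln_of_real[of "real N"] by (simp add: ln_div)
  ultimately have "Ln (- 1 / (of_nat N * w)) = \<i> * of_real pi - Ln (of_nat N) - Ln w" by simp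
  then have "(- 1 / (of_nat N * w)) powr s = exp (s * (\<i> * of_real pi - Ln (of_nat N) - Ln w))"
    using w assms(2) by (simp add: powr_def)
  also have "\<dots> = exp (s * \<i> * of_real pi) * of_nat N powr (- s) * w powr (- s)"
    using w assms(2) by (simp add: powr_def algebra_simps flip: exp_add)
  finally show ?thesis .
qed

text \<open>The matrix \<omega> \<gamma> \<omega>^(-1), written entrywise because \<omega>^(-1) is
  not integral for N > 1. On \<open>Gamma0 N\<close> the division by N is exact.\<close>

definition fricke_conj :: "nat \<Rightarrow> int^2^2 \<Rightarrow> int^2^2" where
  "fricke_conj N \<gamma> =
     vector [vector [\<gamma>$2$2, - (\<gamma>$2$1 div int N)], vector [- (int N * \<gamma>$1$2), \<gamma>$1$1]]"

lemma fricke_conj_nth [simp]: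
  "fricke_conj N \<gamma> $1$1 = \<gamma>$2$2" "fricke_conj N \<gamma> $1$2 = - (\<gamma>$2$1 div int N)"
  "fricke_conj N \<gamma> $2$1 = - (int N * \<gamma>$1$2)" "fricke_conj N \<gamma> $2$2 = \<gamma>$1$1"
  by (simp_all add: fricke_conj_def)

lemma fricke_conj_in_Gamma0:
  assumes "\<gamma> \<in> Gamma0 N"
  shows "fricke_conj N \<gamma> \<in> Gamma0 N"
  using assms by (auto simp: Gamma0_def det_2 algebra_simps)

text \<open>The square of \<omega> is the scalar -N, so conjugating twice is the identity.\<close>

lemma fricke_conj_fricke_conj:
  assumes "N > 0" "\<gamma> \<in> Gamma0 N"
  shows "fricke_conj N (fricke_conj N \<gamma>) = \<gamma>"
proof -
  have "- (int N * \<gamma>$1$2) div int N = - \<gamma>$1$2"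
    using assms(1) by (metis mult_minus_right nonzero_mult_div_cancel_left of_nat_0_less_iff
      less_irrefl)
  with assms show ?thesis by (auto simp: vec_eq_iff forall_2 Gamma0_def)
qed

lemma bij_betw_fricke_conj:
  assumes "N > 0"
  shows "bij_betw (fricke_conj N) (Gamma0 N) (Gamma0 N)"
  by (rule bij_betw_byWitness[where f' = "fricke_conj N"])
     (use assms in \<open>auto simp: fricke_conj_fricke_conj fricke_conj_in_Gamma0\<close>)

lemma omega_action:
  "det (omega N) = int N" "jfactor (omega N) z = of_nat N * z"
  "moebius (omega N) z = - 1 / (of_nat N * z)"
  by (simp_all add: omega_def det_2 jfactor_def moebius_def)

text \<open>Writing \<gamma>' for the conjugate, both claims express \<gamma>' \<omega> = \<omega>
  \<gamma>: the first through the cocycle rule for j, the second through the action on z.\<close>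

lemma fricke_conj_cocycle:
  assumes "N > 0" "\<gamma> \<in> Gamma0 N" "Im z > 0"
  shows "jfactor (fricke_conj N \<gamma>) (- 1 / (of_nat N * z)) * (of_nat N * z) =
           of_nat N * moebius \<gamma> z * jfactor \<gamma> z" (is ?cocycle)
    and "moebius (fricke_conj N \<gamma>) (- 1 / (of_nat N * z)) = - 1 / (of_nat N * moebius \<gamma> z)" (is ?action)
proof -
  obtain c where c: "\<gamma>$2$1 = int N * c" using assms(2) by (auto simp: Gamma0_def)
  have det: "det \<gamma> = 1" using assms(2) by (simp add: Gamma0_def)
  have z: "z \<noteq> 0" and N: "of_nat N \<noteq> (0::complex)" using assms by auto
  have j: "jfactor \<gamma> z \<noteq> 0" and m: "moebius \<gamma> z \<noteq> 0"
    using jfactor_nonzero[OF det assms(3)] Im_moebius_pos[OF det assms(3)] by auto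
  define p q where "p = of_int (\<gamma>$1$1) * z + of_int (\<gamma>$1$2)"
    and "q = of_nat N * of_int c * z + of_int (\<gamma>$2$2)"
  have jq: "jfactor \<gamma> z = q" and mpq: "moebius \<gamma> z = p / q"
    by (simp_all add: jfactor_def moebius_def p_def q_def c)
  have pq: "p \<noteq> 0" "q \<noteq> 0" using j m by (auto simp: jq mpq)
  have jc: "jfactor (fricke_conj N \<gamma>) (- 1 / (of_nat N * z)) = p / z"
    using z N by (simp add: jfactor_def p_def field_simps)
  have nc: "of_int (fricke_conj N \<gamma> $1$1) * (- 1 / (of_nat N * z)) + of_int (fricke_conj N \<gamma> $1$2)
      = - q / (of_nat N * z)"
    using z N assms(1) by (simp add: q_def c field_simps)
  show ?cocycle unfolding jc jq mpq using z N pq by simp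
  have "moebius (fricke_conj N \<gamma>) (- 1 / (of_nat N * z)) = (- q / (of_nat N * z)) / (p / z)"
    unfolding moebius_def nc using jc by (simp add: jfactor_def)
  then show ?action using z N pq by (simp add: mpq)
qed

text \<open>The identity holds for every s, inside the strip or not: reindexing by a bijection and
  extracting a constant factor also respect the value 0 of a divergent
  \<open>infsum\<close>.\<close>

lemma cohen_series_reflect:
  assumes N: "N > 0" and z: "Im z > 0"
  shows "cohen_series N k z (of_nat k - s) =
      exp (s * \<i> * of_real pi) * of_nat N powr (of_nat k / 2 - s) *
      slash k (omega N) (\<lambda>w. cohen_series N k w s) z"
proof -
  \<comment> \<open>\<open>K\<close> collects everything independent of \<gamma>: the factor of the
    theorem and the automorphy factor of \<open>slash\<close>.\<close>
  define K where "K = exp (s * \<i> * of_real pi) * of_nat N powr (of_nat k / 2 - s) *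
    (of_real (real N powr (real k / 2)) / (of_nat N * z) ^ k)"
  let ?wz = "- 1 / (of_nat N * z)"
  let ?t = "\<lambda>\<gamma>. 1 / (moebius \<gamma> ?wz powr s * jfactor \<gamma> ?wz ^ k)"
  have "K * ?t (fricke_conj N \<gamma>) = 1 / (moebius \<gamma> z powr (of_nat k - s) * jfactor \<gamma> z ^ k)"
    if \<gamma>: "\<gamma> \<in> Gamma0 N" for \<gamma>
  proof -
    define w where "w = moebius \<gamma> z"
    have det: "det \<gamma> = 1" using \<gamma> by (simp add: Gamma0_def)
    have w: "Im w > 0" "w \<noteq> 0" using Im_moebius_pos[OF det z] by (auto simp: w_def)
    have zN: "of_nat N * z \<noteq> 0" using N z by auto
    define E P where "E = exp (s * \<i> * of_real pi)" and "P = of_nat N powr (s :: complex)"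
    have nz: "E \<noteq> 0" "P \<noteq> 0" "w powr s \<noteq> 0" "jfactor \<gamma> z \<noteq> 0" "of_nat N \<noteq> (0::complex)"
      using N w jfactor_nonzero[OF det z] by (auto simp: E_def P_def)
    have "moebius (fricke_conj N \<gamma>) ?wz powr s = E / (P * w powr s)"
      using fricke_conj_cocycle(2)[OF N \<gamma> z] minus_inverse_powr[OF w(1) N, of s]
      by (simp add: w_def[symmetric] powr_minus E_def P_def field_simps)
    moreover have "(of_nat N * z) ^ k * jfactor (fricke_conj N \<gamma>) ?wz ^ k =
        of_nat N ^ k * w ^ k * jfactor \<gamma> z ^ k"
      using fricke_conj_cocycle(1)[OF N \<gamma> z]
      by (metis w_def mult.commute power_mult_distrib)
    \<comment> \<open>The two half powers of N combine to N^k, which cancels the N^k from the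
      cocycle relation; \<open>P\<close> cancels against the power of -1/(N w).\<close>
    moreover have "of_nat N powr (of_nat k / 2 - s) * of_real (real N powr (real k / 2))
        = of_nat N ^ k / P"
    proof -
      have "complex_of_real (real N powr (real k / 2)) = of_nat N powr (of_nat k / 2)"
        using powr_of_real[of "real N" "real k / 2"] by simp
      moreover have "of_nat N powr (of_nat k / 2) * of_nat N powr (of_nat k / 2) = (of_nat N ^ k :: complex)"
        using N by (simp add: powr_add[symmetric] powr_nat)
      ultimately show ?thesis by (simp add: powr_diff P_def)
    qed
    moreover have "w powr (of_nat k - s) = w ^ k / w powr s"
      using w by (simp add: powr_diff powr_nat)
    moreover have "K * ?t (fricke_conj N \<gamma>) =
        E * (of_nat N powr (of_nat k / 2 - s) * of_real (real N powr (real k / 2))) /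
        (((of_nat N * z) ^ k * jfactor (fricke_conj N \<gamma>) ?wz ^ k) *
          moebius (fricke_conj N \<gamma>) ?wz powr s)"
      by (simp add: K_def E_def mult_ac)
    ultimately show ?thesis
      using nz w by (simp add: w_def[symmetric])
  qed
  then have "cohen_series N k z (of_nat k - s) = (\<Sum>\<^sub>\<infinity>\<gamma>\<in>Gamma0 N. K * ?t (fricke_conj N \<gamma>))"
    unfolding cohen_series_def by (intro infsum_cong) simp
  also have "\<dots> = (\<Sum>\<^sub>\<infinity>\<gamma>\<in>Gamma0 N. K * ?t \<gamma>)"
    by (rule infsum_reindex_bij_betw[OF bij_betw_fricke_conj[OF N]])
  also have "\<dots> = K * cohen_series N k ?wz s"
    unfolding cohen_series_def by (rule infsum_cmult_right')
  finally show ?thesis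
    by (simp add: slash_def omega_action K_def mult_ac)
qed

theorem theorem5p6:
  fixes N k :: nat and z :: complex
  assumes "N \<ge> 1" and "k \<ge> 6" and "even k" and "Im z > 0"
  shows "\<forall>s :: complex.
    cohen_kernel N k z (of_nat k - s) =
      exp (s * \<i> * of_real pi) * of_nat N powr (of_nat k / 2 - s) *
      slash k (omega N) (\<lambda>w. cohen_kernel N k w s) z"
proof
  fix s :: complex
  let ?S = "{s. 1 < Re s \<and> Re s < real k - 1}"
  define C where "C = complex_of_real (real N powr (real k / 2)) / (of_nat N * z) ^ k"
  \<comment> \<open>With z fixed, the automorphy factor \<open>C\<close> is a nonzero constant, so
    it can be absorbed into the multiplier in s.\<close>
  define h where "h = (\<lambda>s. exp (s * \<i> * of_real pi) * of_nat N powr (of_nat k / 2 - s) * C)"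
  have "z \<noteq> 0" using assms(4) by auto
  then have C: "C \<noteq> 0" using assms(1) by (auto simp: C_def)
  have "entire_continuation ?S (cohen_series N k z) (of_nat k - s) =
      h s * entire_continuation ?S (cohen_series N k (moebius (omega N) z)) s"
  proof (rule entire_continuation_reflect)
    show "open ?S"
      by (intro open_Collect_conj open_Collect_less continuous_intros)
    have "2 \<in> ?S" using assms(2) by simp
    then show "?S \<noteq> {}" by blast
    show "h holomorphic_on UNIV"
      using assms(1) unfolding h_def by (intro holomorphic_intros) auto
    show "cohen_series N k z (of_nat k - s) = h s * cohen_series N k (moebius (omega N) z) s" for s
      using cohen_series_reflect[of N z k s] assms(1,4)
      by (simp add: h_def C_def slash_def omega_action mult_ac)
  qed (use C assms(1) in \<open>auto simp: h_def\<close>)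
  then show "cohen_kernel N k z (of_nat k - s) =
      exp (s * \<i> * of_real pi) * of_nat N powr (of_nat k / 2 - s) *
      slash k (omega N) (\<lambda>w. cohen_kernel N k w s) z"
    by (simp add: cohen_kernel_def slash_def omega_action h_def C_def mult_ac)
qed

end
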